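(* For each $N\ge1$ let $\mathcal{E}(N,\{\delta_k\}_{k=1}^N,\Theta)=\mathcal{E}_0(N,\Theta)+\sum_{k=1}^N\alpha_k(N,\Theta)\delta_k^p$ with $p>0$, $\alpha_k(N,\Theta)>0$, and let $c(\delta)=\delta^{-\gamma}$, $\gamma>0$. Assume that, as $N\to\infty$, $\mathcal{E}_0(N,\Theta)\asymp N^{-\beta}$, $\sum_{j=1}^N\alpha_j(N,\Theta)^{\gamma/(p+\gamma)}\asymp N^{\rho}$ and $\sum_{j=1}^N\alpha_j(N,\Theta)\asymp N^{\sigma}$, with $\beta>0$, $\rho>0$, $\sigma\in\mathbb{R}$ and $p+\sigma\gamma>0$. Let $T_{\mathrm{total}}(N^* )$ be the minimum of $\sum_{k=1}^N\delta_k^{-\gamma}$ over $N\ge1$ and $\delta_1,\dots,\delta_N>0$ subject to $\mathcal{E}(N,\{\delta_k\},\Theta)\le\varepsilon$, and let $T^{\mathrm{unif}}_{\mathrm{total}}(\widetilde N^* )$ be the minimum of the same quantity under the additional restriction $\delta_1=\dots=\delta_N$. Then, as $\varepsilon\to0$, $$R_{\mathrm{opt}}(\varepsilon,\gamma):=\frac{T_{\mathrm{total}}(N^* )}{T^{\mathrm{unif}}_{\mathrm{total}}(\widetilde N^* )}\asymp\varepsilon^{\Delta/(\beta p)},\qquad \Delta:=p+\sigma\gamma-\rho(p+\gamma),$$ and $\Delta\ge0$.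
   Context: A zeroth-order method makes $N$ steps; at step $k$ it queries an oracle with fidelity $\delta_k>0$ at cost $c(\delta_k)$; the wall-clock time is $\sum_{k=1}^N c(\delta_k)$. $\mathcal{E}$ is a deterministic upper bound on the convergence metric, $\Theta$ denotes fixed hyperparameters, $\varepsilon$ is the target accuracy. $u\asymp v$ means that $u/v$ is bounded above and below by positive constants not depending on $N$ or $\varepsilon$. *)

theory Defs
  imports Complex_Main
begin

definition same_order :: "'a filter \<Rightarrow> ('a \<Rightarrow> real) \<Rightarrow> ('a \<Rightarrow> real) \<Rightarrow> bool" where
  "same_order F u v \<longleftrightarrow>
     (\<exists>c C. 0 < c \<and> 0 < C \<and> (\<forall>\<^sub>F x in F. c \<le> u x / v x \<and> u x / v x \<le> C))"

definition is_minimum :: "real set \<Rightarrow> real \<Rightarrow> bool" where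
  "is_minimum S t \<longleftrightarrow> t \<in> S \<and> (\<forall>s\<in>S. t \<le> s)"

definition oracle_cost :: "real \<Rightarrow> real \<Rightarrow> real" where
  "oracle_cost \<gamma> d = d powr (- \<gamma>)"

definition wall_clock :: "(real \<Rightarrow> real) \<Rightarrow> nat \<Rightarrow> (nat \<Rightarrow> real) \<Rightarrow> real" where
  "wall_clock c N \<delta> = (\<Sum>k=1..N. c (\<delta> k))"

text \<open>
  A fidelity schedule is a function on the natural numbers of which only the values at
  1, ..., N matter. The bound \<open>\<E>\<close> takes the number of steps, the schedule and the
  hyperparameters.
\<close>

definition feasible ::
  "(nat \<Rightarrow> (nat \<Rightarrow> real) \<Rightarrow> 'h \<Rightarrow> real) \<Rightarrow> 'h \<Rightarrow> real \<Rightarrow> nat \<Rightarrow> (nat \<Rightarrow> real) \<Rightarrow> bool" where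
  "feasible \<E> \<Theta> \<epsilon> N \<delta> \<longleftrightarrow> 1 \<le> N \<and> (\<forall>k\<in>{1..N}. 0 < \<delta> k) \<and> \<E> N \<delta> \<Theta> \<le> \<epsilon>"

definition attainable_times ::
  "(nat \<Rightarrow> (nat \<Rightarrow> real) \<Rightarrow> 'h \<Rightarrow> real) \<Rightarrow> 'h \<Rightarrow> real \<Rightarrow> real \<Rightarrow> real set" where
  "attainable_times \<E> \<Theta> \<epsilon> \<gamma> =
     {wall_clock (oracle_cost \<gamma>) N \<delta> | N \<delta>. feasible \<E> \<Theta> \<epsilon> N \<delta>}"

definition attainable_times_unif ::
  "(nat \<Rightarrow> (nat \<Rightarrow> real) \<Rightarrow> 'h \<Rightarrow> real) \<Rightarrow> 'h \<Rightarrow> real \<Rightarrow> real \<Rightarrow> real set" where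
  "attainable_times_unif \<E> \<Theta> \<epsilon> \<gamma> =
     {wall_clock (oracle_cost \<gamma>) N \<delta> | N \<delta>.
        feasible \<E> \<Theta> \<epsilon> N \<delta> \<and> (\<forall>j\<in>{1..N}. \<forall>k\<in>{1..N}. \<delta> j = \<delta> k)}"

text \<open>
  The two definitions below name the minimum by a description, which is meaningful only if
  the minimum exists; combine them with \<^const>\<open>is_minimum\<close>.
\<close>

definition T_total ::
  "(nat \<Rightarrow> (nat \<Rightarrow> real) \<Rightarrow> 'h \<Rightarrow> real) \<Rightarrow> 'h \<Rightarrow> real \<Rightarrow> real \<Rightarrow> real" where
  "T_total \<E> \<Theta> \<epsilon> \<gamma> = (THE t. is_minimum (attainable_times \<E> \<Theta> \<epsilon> \<gamma>) t)"

definition T_total_unif ::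
  "(nat \<Rightarrow> (nat \<Rightarrow> real) \<Rightarrow> 'h \<Rightarrow> real) \<Rightarrow> 'h \<Rightarrow> real \<Rightarrow> real \<Rightarrow> real" where
  "T_total_unif \<E> \<Theta> \<epsilon> \<gamma> = (THE t. is_minimum (attainable_times_unif \<E> \<Theta> \<epsilon> \<gamma>) t)"

definition R_opt ::
  "(nat \<Rightarrow> (nat \<Rightarrow> real) \<Rightarrow> 'h \<Rightarrow> real) \<Rightarrow> 'h \<Rightarrow> real \<Rightarrow> real \<Rightarrow> real" where
  "R_opt \<E> \<Theta> \<epsilon> \<gamma> = T_total \<E> \<Theta> \<epsilon> \<gamma> / T_total_unif \<E> \<Theta> \<epsilon> \<gamma>"

end

theory Submission
  imports Defs
begin

text \<open>
  Fix the number \<open>N\<close> of steps and write \<open>s = \<gamma> / p\<close>, \<open>r = \<epsilon> - \<E>\<^sub>0 N\<close> and \<open>x\<^sub>k = \<delta>\<^sub>k\<^sup>p\<close>. The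
  constraint becomes linear, \<open>\<Sum>k. \<alpha>\<^sub>k x\<^sub>k \<le> r\<close>, and the cost \<open>\<Sum>k. x\<^sub>k powr (- s)\<close> is convex, so
  the tangent at the Lagrange point decides the problem (\<open>allocation_cost_ge\<close>): the least cost is
  \<open>A powr (1 + s) * r powr (- s)\<close> with \<open>A = \<Sum>k. \<alpha>\<^sub>k powr (s / (1 + s))\<close>. For a constant
  schedule it is \<open>N * S powr s * r powr (- s)\<close> with \<open>S = \<Sum>k. \<alpha>\<^sub>k\<close>, by monotonicity alone.

  Both problems thus reduce to one over \<open>N\<close>: minimise \<open>W N * (\<epsilon> - \<E>\<^sub>0 N) powr (- s)\<close> where
  \<open>W N\<close> has order \<open>N powr \<tau>\<close>, with \<open>\<tau> = \<rho> (1 + s)\<close> in the free case and \<open>\<tau> = 1 + \<sigma> s\<close> in the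
  uniform one; the hypotheses on \<open>\<rho>\<close> and \<open>\<sigma>\<close> say that \<open>\<tau>\<close> is positive. Then large \<open>N\<close> are never
  worthwhile, so a minimum exists (\<open>reduced_costs_minimum\<close>). Feasibility forces \<open>N\<close> to be at least
  of order \<open>\<epsilon> powr (- 1 / \<beta>)\<close>, and a suitable \<open>N\<close> of that order leaves half of \<open>\<epsilon>\<close> for the
  oracle errors; so the minimum has order \<open>\<epsilon> powr - (\<tau> / \<beta> + s)\<close> (\<open>reduced_costs_order\<close>).

  The exponent of the ratio is the difference of the two values of \<open>\<tau>\<close>, divided by \<open>\<beta>\<close>, which is
  \<open>\<Delta> / (\<beta> p)\<close>. Constant schedules being admissible in the free problem, the ratio is at most 1,
  and a negative \<open>\<Delta>\<close> would make it unbounded.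
\<close>

section \<open>Minima of sets of reals\<close>

lemma is_minimum_The:
  assumes "is_minimum S t"
  shows "(THE u. is_minimum S u) = t"
  using assms by (intro the_equality) (auto simp: is_minimum_def intro: order_antisym)

lemma is_minimum_cofinal:
  assumes "V \<subseteq> S" and "\<And>x. x \<in> S \<Longrightarrow> \<exists>v\<in>V. v \<le> x" and "is_minimum V t"
  shows "is_minimum S t"
  using assms unfolding is_minimum_def by (meson order_trans subsetD)

section \<open>Calculus of orders of growth\<close>

lemma same_order_mult:
  assumes "same_order F u v" "same_order F u' v'"
  shows "same_order F (\<lambda>x. u x * u' x) (\<lambda>x. v x * v' x)"
proof -
  obtain c C where c: "0 < c" "0 < C" "\<forall>\<^sub>F x in F. c \<le> u x / v x \<and> u x / v x \<le> C"
    using assms(1) unfolding same_order_def by blast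
  obtain d D where d: "0 < d" "0 < D" "\<forall>\<^sub>F x in F. d \<le> u' x / v' x \<and> u' x / v' x \<le> D"
    using assms(2) unfolding same_order_def by blast
  have "\<forall>\<^sub>F x in F. c * d \<le> (u x * u' x) / (v x * v' x) \<and> (u x * u' x) / (v x * v' x) \<le> C * D"
    using c(3) d(3)
  proof eventually_elim
    case (elim x)
    have "c * d \<le> (u x / v x) * (u' x / v' x)" "(u x / v x) * (u' x / v' x) \<le> C * D"
      by (intro mult_mono; use elim c d in linarith)+
    then show ?case by simp
  qed
  then show ?thesis
    using c d unfolding same_order_def by (intro exI[of _ "c * d"] exI[of _ "C * D"]) auto
qed

lemma same_order_powr:
  assumes "same_order F u v"
  shows "same_order F (\<lambda>x. u x powr a) (\<lambda>x. v x powr a)"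
proof -
  obtain c C where c: "0 < c" "0 < C" "\<forall>\<^sub>F x in F. c \<le> u x / v x \<and> u x / v x \<le> C"
    using assms unfolding same_order_def by blast
  let ?m = "min (c powr a) (C powr a)" and ?M = "max (c powr a) (C powr a)"
  have "\<forall>\<^sub>F x in F. ?m \<le> u x powr a / v x powr a \<and> u x powr a / v x powr a \<le> ?M"
    using c(3)
  proof eventually_elim
    case (elim x)
    have "?m \<le> (u x / v x) powr a \<and> (u x / v x) powr a \<le> ?M"
    proof (cases "0 \<le> a")
      case True
      then show ?thesis
        using elim c powr_mono2[of a c "u x / v x"] powr_mono2[of a "u x / v x" C] by linarith
    next
      case False
      then show ?thesis
        using elim c powr_mono2'[of a c "u x / v x"] powr_mono2'[of a "u x / v x" C] by linarith
    qed
    then show ?case by (simp only: powr_divide)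
  qed
  moreover have "0 < ?m" "0 < ?M" using c by (auto simp: less_max_iff_disj)
  ultimately show ?thesis unfolding same_order_def by blast
qed

lemma same_order_refl_pos:
  assumes "\<forall>\<^sub>F x in F. 0 < u x"
  shows "same_order F u (u :: 'a \<Rightarrow> real)"
  unfolding same_order_def using assms
  by (intro exI[of _ 1] conjI) (auto elim: eventually_mono)

lemma same_order_divide:
  assumes "same_order F u v" "same_order F u' v'"
  shows "same_order F (\<lambda>x. u x / u' x) (\<lambda>x. v x / v' x)"
proof -
  obtain c C where c: "0 < c" "0 < C" "\<forall>\<^sub>F x in F. c \<le> u x / v x \<and> u x / v x \<le> C"
    using assms(1) unfolding same_order_def by blast
  obtain d D where d: "0 < d" "0 < D" "\<forall>\<^sub>F x in F. d \<le> u' x / v' x \<and> u' x / v' x \<le> D"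
    using assms(2) unfolding same_order_def by blast
  have "\<forall>\<^sub>F x in F. c / D \<le> (u x / u' x) / (v x / v' x) \<and> (u x / u' x) / (v x / v' x) \<le> C / d"
    using c(3) d(3)
  proof eventually_elim
    case (elim x)
    have "c / D \<le> (u x / v x) / (u' x / v' x)" "(u x / v x) / (u' x / v' x) \<le> C / d"
      by (intro frac_le; use elim c d in linarith)+
    moreover have "(u x / v x) / (u' x / v' x) = (u x / u' x) / (v x / v' x)"
      by simp
    ultimately show ?case by argo
  qed
  then show ?thesis
    using c d unfolding same_order_def by (intro exI[of _ "c / D"] exI[of _ "C / d"]) auto
qed

text \<open>
  Finitely many terms only change the constants, so for positive sequences an asymptotic order
  gives two-sided bounds at every index; this spares a threshold on \<open>N\<close> in what follows.
\<close>

lemma same_order_sequentially_bounds: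
  assumes "same_order sequentially u v"
    and "\<And>n. 1 \<le> n \<Longrightarrow> 0 < u n" and "\<And>n. 1 \<le> n \<Longrightarrow> 0 < v n"
  obtains c C where "0 < c" "0 < C" "\<And>n. 1 \<le> n \<Longrightarrow> c * v n \<le> u n" "\<And>n. 1 \<le> n \<Longrightarrow> u n \<le> C * v n"
proof -
  obtain c C M where c: "0 < c" "0 < C" "\<And>n. M \<le> n \<Longrightarrow> c \<le> u n / v n \<and> u n / v n \<le> C"
    using assms(1) unfolding same_order_def eventually_sequentially by blast
  define B where "B = (\<lambda>n. u n / v n) ` {1..M}"
  have B: "finite B" "\<And>y. y \<in> B \<Longrightarrow> 0 < y"
    using assms by (auto simp: B_def)
  have *: "Min (insert c B) \<le> u n / v n \<and> u n / v n \<le> Max (insert C B)" if "1 \<le> n" for n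
  proof (cases "M \<le> n")
    case True
    then show ?thesis
      using c(3)[OF True] B(1) by (meson Max_ge Min_le finite_insert insertI1 order_trans)
  next
    case False
    then have "u n / v n \<in> B" using that by (auto simp: B_def)
    then show ?thesis using B(1) by simp
  qed
  show thesis
  proof (rule that)
    show "0 < Min (insert c B)" using B c by simp
    have "C \<le> Max (insert C B)" using B(1) by simp
    then show "0 < Max (insert C B)" using c(2) by linarith
    show "Min (insert c B) * v n \<le> u n" "u n \<le> Max (insert C B) * v n" if "1 \<le> n" for n
      using *[OF that] assms(3)[OF that] by (auto simp: pos_le_divide_eq pos_divide_le_eq)
  qed
qed

section \<open>Optimal fidelities for a fixed number of steps\<close>

lemma powr_neg_tangent:
  fixes s y :: real
  assumes "0 \<le> s" "0 < y"
  shows "1 + s - s * y \<le> y powr (- s)"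
proof -
  have "s * ln y \<le> s * (y - 1)"
    using assms ln_le_minus_one by (intro mult_left_mono) auto
  then have "1 + s - s * y \<le> 1 + (- s) * ln y" by (simp add: algebra_simps)
  also have "\<dots> \<le> exp ((- s) * ln y)" by (rule exp_ge_add_one_self)
  finally show ?thesis using assms by (simp add: powr_def)
qed

text \<open>
  The tangent is taken at \<open>K * a\<^sub>k powr (- 1 / (1 + s))\<close>, where the derivative of the cost is
  proportional to \<open>a\<^sub>k\<close>. Summed, the tangents bound the cost in terms of \<open>\<Sum>k. a\<^sub>k x\<^sub>k\<close>
  alone, and \<open>K = r / A\<close> makes the tangent point use the budget exactly.
\<close>

lemma allocation_cost_ge:
  fixes a x :: "'i \<Rightarrow> real" and s r :: real
  assumes "finite I" "I \<noteq> {}" and a: "\<And>k. k \<in> I \<Longrightarrow> 0 < a k" and x: "\<And>k. k \<in> I \<Longrightarrow> 0 < x k"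
    and s: "0 < s" and r: "0 < r" and budget: "(\<Sum>k\<in>I. a k * x k) \<le> r"
  shows "(\<Sum>k\<in>I. a k powr (s / (1 + s))) powr (1 + s) * r powr (- s) \<le> (\<Sum>k\<in>I. x k powr (- s))"
proof -
  define A where "A = (\<Sum>k\<in>I. a k powr (s / (1 + s)))"
  define K where "K = r / A"
  have A: "0 < A"
    unfolding A_def using assms by (intro sum_pos) force+
  then have K: "0 < K" using r by (simp add: K_def)
  have term_ge: "(1 + s) * K powr (- s) * a k powr (s / (1 + s)) - s * K powr (- s - 1) * (a k * x k)
      \<le> x k powr (- s)" if "k \<in> I" for k
  proof -
    define x\<^sub>0 where "x\<^sub>0 = K * a k powr (- 1 / (1 + s))"
    have pos: "0 < a k" "0 < x k" "0 < x\<^sub>0" using that a[OF that] x K by (auto simp: x\<^sub>0_def)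
    have val: "x\<^sub>0 powr (- s) = K powr (- s) * a k powr (s / (1 + s))"
      by (simp add: x\<^sub>0_def powr_mult powr_powr)
    have "(- 1 / (1 + s)) * (- s - 1) = 1" using s by (simp add: field_simps)
    then have slope: "x\<^sub>0 powr (- s - 1) = K powr (- s - 1) * a k"
      using pos by (simp add: x\<^sub>0_def powr_mult powr_powr del: times_divide_eq_left)
    have split: "x\<^sub>0 powr (- s) / x\<^sub>0 = x\<^sub>0 powr (- s - 1)"
      using pos by (simp add: powr_diff)
    have "(1 + s) * x\<^sub>0 powr (- s) - s * x\<^sub>0 powr (- s - 1) * x k
        = x\<^sub>0 powr (- s) * (1 + s - s * (x k / x\<^sub>0))"
      unfolding split[symmetric] by (simp add: algebra_simps)
    also have "\<dots> \<le> x\<^sub>0 powr (- s) * (x k / x\<^sub>0) powr (- s)"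
      using powr_neg_tangent[of s "x k / x\<^sub>0"] s pos by (intro mult_left_mono) auto
    also have "\<dots> = x k powr (- s)"
      using pos by (simp add: powr_divide)
    finally show ?thesis
      unfolding val slope by (simp add: mult_ac)
  qed
  have "A powr (1 + s) * r powr (- s) = A * K powr (- s)"
    using A by (simp add: K_def powr_divide powr_add powr_minus field_simps)
  also have "\<dots> = (1 + s) * K powr (- s) * A - s * (K powr (- s) / K) * r"
    using A r by (simp add: K_def field_simps)
  also have "K powr (- s) / K = K powr (- s - 1)"
    using K by (simp add: powr_diff)
  also have "(1 + s) * K powr (- s) * A - s * K powr (- s - 1) * r
      \<le> (1 + s) * K powr (- s) * A - s * K powr (- s - 1) * (\<Sum>k\<in>I. a k * x k)"
    using budget s by (intro diff_left_mono mult_left_mono) auto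
  also have "\<dots> = (\<Sum>k\<in>I. (1 + s) * K powr (- s) * a k powr (s / (1 + s))
      - s * K powr (- s - 1) * (a k * x k))"
    by (simp add: A_def sum_subtractf sum_distrib_left)
  also have "\<dots> \<le> (\<Sum>k\<in>I. x k powr (- s))"
    by (intro sum_mono term_ge)
  finally show ?thesis by (simp add: A_def)
qed

lemma allocation_cost_attained:
  fixes a :: "'i \<Rightarrow> real" and s r :: real
  assumes "finite I" "I \<noteq> {}" and a: "\<And>k. k \<in> I \<Longrightarrow> 0 < a k" and s: "0 < s" and r: "0 < r"
  obtains x :: "'i \<Rightarrow> real" where "\<And>k. k \<in> I \<Longrightarrow> 0 < x k" "(\<Sum>k\<in>I. a k * x k) = r"
    "(\<Sum>k\<in>I. x k powr (- s)) = (\<Sum>k\<in>I. a k powr (s / (1 + s))) powr (1 + s) * r powr (- s)"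
proof -
  define A where "A = (\<Sum>k\<in>I. a k powr (s / (1 + s)))"
  define x where "x k = r / A * a k powr (- 1 / (1 + s))" for k
  have A: "0 < A"
    unfolding A_def using assms by (intro sum_pos) force+
  have "a k * x k = r / A * a k powr (s / (1 + s))" if "k \<in> I" for k
  proof -
    have "a k powr (s / (1 + s)) = a k powr (1 + - 1 / (1 + s))"
      using s by (intro arg_cong[where f = "(powr) (a k)"]) (simp add: field_simps)
    also have "\<dots> = a k * a k powr (- 1 / (1 + s))"
      unfolding powr_add using a[OF that] by simp
    finally show ?thesis by (simp add: x_def)
  qed
  then have "(\<Sum>k\<in>I. a k * x k) = r / A * A"
    by (simp add: A_def sum_distrib_left)
  moreover have "x k powr (- s) = (r / A) powr (- s) * a k powr (s / (1 + s))" for k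
    unfolding x_def powr_mult powr_powr by simp
  then have "(\<Sum>k\<in>I. x k powr (- s)) = (r / A) powr (- s) * A"
    by (simp add: A_def sum_distrib_left)
  moreover have "(r / A) powr (- s) * A = A powr (1 + s) * r powr (- s)"
    using A by (simp add: powr_divide powr_add powr_minus field_simps)
  ultimately show thesis
    using A r a by (intro that[of x]) (force simp: x_def A_def)+
qed

section \<open>Optimal number of steps\<close>

text \<open>
  The cost that remains once the fidelities have been optimised: \<open>W N\<close> is the least cost of \<open>N\<close>
  steps with budget 1 for the oracle errors, and \<open>\<epsilon> - e N\<close> is the budget that the deterministic
  error leaves.
\<close>

definition reduced_costs :: "(nat \<Rightarrow> real) \<Rightarrow> (nat \<Rightarrow> real) \<Rightarrow> real \<Rightarrow> real \<Rightarrow> real set" where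
  "reduced_costs W e s \<epsilon> = {W N * (\<epsilon> - e N) powr (- s) | N. 1 \<le> N \<and> e N < \<epsilon>}"

text \<open>
  Every reduced cost is at least \<open>W N * \<epsilon> powr (- s)\<close>, and \<open>W N\<close> tends to infinity; so only
  finitely many \<open>N\<close> can compete with a given feasible one.
\<close>

lemma reduced_costs_minimum:
  assumes e: "same_order sequentially e (\<lambda>N. real N powr (- \<beta>))"
    and W: "same_order sequentially W (\<lambda>N. real N powr \<tau>)"
    and pos: "\<And>N. 1 \<le> N \<Longrightarrow> 0 < e N" "\<And>N. 1 \<le> N \<Longrightarrow> 0 < W N"
    and par: "0 < \<beta>" "0 < \<tau>" "0 < s" and \<epsilon>: "0 < \<epsilon>"
  shows "\<exists>t. is_minimum (reduced_costs W e s \<epsilon>) t"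
proof -
  obtain c C where c: "0 < c" "0 < C"
      "\<And>N. 1 \<le> N \<Longrightarrow> c * real N powr (- \<beta>) \<le> e N" "\<And>N. 1 \<le> N \<Longrightarrow> e N \<le> C * real N powr (- \<beta>)"
    using same_order_sequentially_bounds[OF e pos(1)] by auto
  obtain d D where d: "0 < d" "0 < D"
      "\<And>N. 1 \<le> N \<Longrightarrow> d * real N powr \<tau> \<le> W N" "\<And>N. 1 \<le> N \<Longrightarrow> W N \<le> D * real N powr \<tau>"
    using same_order_sequentially_bounds[OF W pos(2)] by auto
  define f where "f N = W N * (\<epsilon> - e N) powr (- s)" for N
  have "(\<lambda>N. C * real N powr (- \<beta>)) \<longlonglongrightarrow> C * 0"
    using par by (intro tendsto_mult tendsto_const tendsto_neg_powr filterlim_real_sequentially) simp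
  then have "\<forall>\<^sub>F N in sequentially. C * real N powr (- \<beta>) < \<epsilon>"
    using \<epsilon> by (auto dest: order_tendstoD(2))
  then obtain M where M: "\<And>N. M \<le> N \<Longrightarrow> C * real N powr (- \<beta>) < \<epsilon>"
    by (auto simp: eventually_sequentially)
  define n where "n = max M 1"
  have n: "1 \<le> n" "e n < \<epsilon>"
    using M[of n] c(4)[of n] by (auto simp: n_def)
  define S where "S = {N. 1 \<le> N \<and> e N < \<epsilon> \<and> f N \<le> f n}"
  have "N \<le> nat \<lfloor>(f n / (d * \<epsilon> powr (- s))) powr (1 / \<tau>)\<rfloor>" if "N \<in> S" for N
  proof -
    have N: "1 \<le> N" "e N < \<epsilon>" "f N \<le> f n" using that by (auto simp: S_def)
    have "d * real N powr \<tau> * \<epsilon> powr (- s) \<le> f N"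
      unfolding f_def using N pos(1)[of N] par d(1,3)
      by (intro mult_mono powr_mono2') (auto simp: less_imp_le pos)
    then have "real N powr \<tau> * (d * \<epsilon> powr (- s)) \<le> f n"
      using N(3) by (simp add: mult_ac)
    then have "real N powr \<tau> \<le> f n / (d * \<epsilon> powr (- s))"
      using d(1) \<epsilon> by (subst pos_le_divide_eq) auto
    then have "(real N powr \<tau>) powr (1 / \<tau>) \<le> (f n / (d * \<epsilon> powr (- s))) powr (1 / \<tau>)"
      using par by (intro powr_mono2) auto
    then have "real N \<le> (f n / (d * \<epsilon> powr (- s))) powr (1 / \<tau>)"
      using par N(1) by (simp add: powr_powr)
    then show ?thesis by (simp add: le_nat_floor)
  qed
  then have fin: "finite S"
    unfolding finite_nat_set_iff_bounded_le by blast
  have "n \<in> S" using n by (simp add: S_def)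
  then have "Min (f ` S) \<in> f ` S" using fin by (intro Min_in) auto
  then obtain m where m: "m \<in> S" "f m = Min (f ` S)" by auto
  have le: "f m \<le> f N" if "1 \<le> N" "e N < \<epsilon>" for N
  proof (cases "N \<in> S")
    case True
    then show ?thesis using fin m by simp
  next
    case False
    then show ?thesis using that m(1) by (auto simp: S_def)
  qed
  have "f m \<in> reduced_costs W e s \<epsilon>"
    using m(1) unfolding reduced_costs_def f_def S_def by blast
  moreover have "\<forall>v\<in>reduced_costs W e s \<epsilon>. f m \<le> v"
    using le unfolding reduced_costs_def f_def by blast
  ultimately show ?thesis unfolding is_minimum_def by blast
qed

text \<open>
  For the upper bound \<open>N\<close> is chosen from the bound \<open>e N \<le> C * N powr (- \<beta>)\<close> so that
  \<open>e N \<le> \<epsilon> / 2\<close>; the budget of the oracle errors is then within a factor 2 of \<open>\<epsilon>\<close>, and \<open>N\<close>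
  within a constant factor of the least that feasibility allows.
\<close>

lemma reduced_costs_order:
  assumes e: "same_order sequentially e (\<lambda>N. real N powr (- \<beta>))"
    and W: "same_order sequentially W (\<lambda>N. real N powr \<tau>)"
    and pos: "\<And>N. 1 \<le> N \<Longrightarrow> 0 < e N" "\<And>N. 1 \<le> N \<Longrightarrow> 0 < W N"
    and par: "0 < \<beta>" "0 < \<tau>" "0 < s"
    and t: "\<And>\<epsilon>. 0 < \<epsilon> \<Longrightarrow> is_minimum (reduced_costs W e s \<epsilon>) (t \<epsilon>)"
  shows "same_order (at_right 0) t (\<lambda>\<epsilon>. \<epsilon> powr (- (\<tau> / \<beta> + s)))"
proof -
  obtain c C where c: "0 < c" "0 < C"
      "\<And>N. 1 \<le> N \<Longrightarrow> c * real N powr (- \<beta>) \<le> e N" "\<And>N. 1 \<le> N \<Longrightarrow> e N \<le> C * real N powr (- \<beta>)"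
    using same_order_sequentially_bounds[OF e pos(1)] by auto
  obtain d D where d: "0 < d" "0 < D"
      "\<And>N. 1 \<le> N \<Longrightarrow> d * real N powr \<tau> \<le> W N" "\<And>N. 1 \<le> N \<Longrightarrow> W N \<le> D * real N powr \<tau>"
    using same_order_sequentially_bounds[OF W pos(2)] by auto
  define l where "l = d * c powr (\<tau> / \<beta>)"
  define u where "u = D * 2 powr \<tau> * (2 * C) powr (\<tau> / \<beta>) * 2 powr s"
  have lower: "l * \<epsilon> powr (- (\<tau> / \<beta> + s)) \<le> t \<epsilon>" if \<epsilon>: "0 < \<epsilon>" for \<epsilon>
  proof -
    obtain N where N: "1 \<le> N" "e N < \<epsilon>" "t \<epsilon> = W N * (\<epsilon> - e N) powr (- s)"
      using t[OF \<epsilon>] by (auto simp: is_minimum_def reduced_costs_def)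
    have "c * real N powr (- \<beta>) \<le> \<epsilon>"
      using c(3)[OF N(1)] N(2) by simp
    then have "real N powr (- \<beta>) \<le> \<epsilon> / c"
      using c(1) by (simp add: field_simps)
    then have "(\<epsilon> / c) powr (- (\<tau> / \<beta>)) \<le> (real N powr (- \<beta>)) powr (- (\<tau> / \<beta>))"
      using par N(1) by (intro powr_mono2') auto
    also have "\<dots> = real N powr \<tau>"
      using par by (simp add: powr_powr)
    finally have "d * (\<epsilon> / c) powr (- (\<tau> / \<beta>)) \<le> d * real N powr \<tau>"
      using d(1) by simp
    also have "\<dots> \<le> W N" by (rule d(3)[OF N(1)])
    finally have "d * (\<epsilon> / c) powr (- (\<tau> / \<beta>)) * \<epsilon> powr (- s) \<le> t \<epsilon>"
      unfolding N(3) using pos(1)[OF N(1)] pos(2)[OF N(1)] N par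
      by (intro mult_mono powr_mono2') auto
    then show ?thesis
      by (simp add: l_def powr_divide powr_diff powr_minus field_simps)
  qed
  have upper: "t \<epsilon> \<le> u * \<epsilon> powr (- (\<tau> / \<beta> + s))" if \<epsilon>: "0 < \<epsilon>" "\<epsilon> < 2 * C" for \<epsilon>
  proof -
    define x where "x = (2 * C / \<epsilon>) powr (1 / \<beta>)"
    have x: "1 \<le> x"
      unfolding x_def using \<epsilon> par by (intro ge_one_powr_ge_zero) auto
    define N where "N = nat \<lceil>x\<rceil>"
    have N: "x \<le> real N" "real N \<le> 2 * x" "1 \<le> N"
      using x unfolding N_def by linarith+
    have "real N powr (- \<beta>) \<le> x powr (- \<beta>)"
      using N x par by (intro powr_mono2') auto
    also have "\<dots> = \<epsilon> / (2 * C)"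
      using par \<epsilon> c(2) by (simp add: x_def powr_powr powr_minus)
    finally have "C * real N powr (- \<beta>) \<le> \<epsilon> / 2"
      using c(2) by (simp add: field_simps)
    then have eN: "e N \<le> \<epsilon> / 2"
      using c(4)[OF N(3)] by linarith
    have "W N * (\<epsilon> - e N) powr (- s) \<in> reduced_costs W e s \<epsilon>"
      using N(3) eN \<epsilon> unfolding reduced_costs_def by force
    then have "t \<epsilon> \<le> W N * (\<epsilon> - e N) powr (- s)"
      using t[OF \<epsilon>(1)] by (auto simp: is_minimum_def)
    also have "\<dots> \<le> (D * (2 * x) powr \<tau>) * (\<epsilon> / 2) powr (- s)"
    proof (intro mult_mono)
      have "D * real N powr \<tau> \<le> D * (2 * x) powr \<tau>"
        using N d(2) par by (intro mult_left_mono powr_mono2) auto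
      then show "W N \<le> D * (2 * x) powr \<tau>"
        using d(4)[OF N(3)] by linarith
      show "(\<epsilon> - e N) powr (- s) \<le> (\<epsilon> / 2) powr (- s)"
        using eN \<epsilon> par by (intro powr_mono2') auto
    qed (use d(2) in auto)
    also have "\<dots> = u * \<epsilon> powr (- (\<tau> / \<beta> + s))"
      by (simp add: u_def x_def powr_mult powr_divide powr_powr powr_diff powr_minus field_simps)
    finally show ?thesis .
  qed
  have "\<forall>\<^sub>F \<epsilon> in at_right 0. (0::real) < \<epsilon> \<and> \<epsilon> < 2 * C"
    using c(2) by (auto simp: eventually_at_right_field intro!: exI[of _ "2 * C"])
  then have "\<forall>\<^sub>F \<epsilon> in at_right 0. l \<le> t \<epsilon> / \<epsilon> powr (- (\<tau> / \<beta> + s))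
      \<and> t \<epsilon> / \<epsilon> powr (- (\<tau> / \<beta> + s)) \<le> u"
    by eventually_elim (use lower upper in \<open>auto simp: pos_le_divide_eq pos_divide_le_eq\<close>)
  moreover have "0 < l" "0 < u" using c d by (auto simp: l_def u_def)
  ultimately show ?thesis unfolding same_order_def by blast
qed

section \<open>The two minimal times\<close>

theorem mainTheorem4:
  fixes \<E> :: "nat \<Rightarrow> (nat \<Rightarrow> real) \<Rightarrow> 'h \<Rightarrow> real"
    and \<E>\<^sub>0 :: "nat \<Rightarrow> 'h \<Rightarrow> real"
    and \<alpha> :: "nat \<Rightarrow> nat \<Rightarrow> 'h \<Rightarrow> real"
    and \<Theta> :: 'h
    and p \<gamma> \<beta> \<rho> \<sigma> \<Delta> :: real
  assumes bound: "\<And>N \<delta>. 1 \<le> N \<Longrightarrow> (\<forall>k\<in>{1..N}. 0 < \<delta> k) \<Longrightarrow>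
                    \<E> N \<delta> \<Theta> = \<E>\<^sub>0 N \<Theta> + (\<Sum>k=1..N. \<alpha> k N \<Theta> * \<delta> k powr p)"
    and p_pos: "0 < p"
    and \<gamma>_pos: "0 < \<gamma>"
    and \<alpha>_pos: "\<And>N k. 1 \<le> k \<Longrightarrow> k \<le> N \<Longrightarrow> 0 < \<alpha> k N \<Theta>"
    and \<E>\<^sub>0_pos: "\<And>N. 1 \<le> N \<Longrightarrow> 0 < \<E>\<^sub>0 N \<Theta>"
    and \<E>\<^sub>0_order: "same_order sequentially (\<lambda>N. \<E>\<^sub>0 N \<Theta>) (\<lambda>N. real N powr (- \<beta>))"
    and \<alpha>_powr_order: "same_order sequentially
           (\<lambda>N. \<Sum>j=1..N. \<alpha> j N \<Theta> powr (\<gamma> / (p + \<gamma>))) (\<lambda>N. real N powr \<rho>)"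
    and \<alpha>_order: "same_order sequentially
           (\<lambda>N. \<Sum>j=1..N. \<alpha> j N \<Theta>) (\<lambda>N. real N powr \<sigma>)"
    and \<beta>_pos: "0 < \<beta>"
    and \<rho>_pos: "0 < \<rho>"
    and \<sigma>_cond: "0 < p + \<sigma> * \<gamma>"
    and \<Delta>_eq: "\<Delta> = p + \<sigma> * \<gamma> - \<rho> * (p + \<gamma>)"
  shows "(\<forall>\<epsilon>>0. is_minimum (attainable_times \<E> \<Theta> \<epsilon> \<gamma>) (T_total \<E> \<Theta> \<epsilon> \<gamma>)
               \<and> is_minimum (attainable_times_unif \<E> \<Theta> \<epsilon> \<gamma>) (T_total_unif \<E> \<Theta> \<epsilon> \<gamma>))
       \<and> same_order (at_right 0) (\<lambda>\<epsilon>. R_opt \<E> \<Theta> \<epsilon> \<gamma>) (\<lambda>\<epsilon>. \<epsilon> powr (\<Delta> / (\<beta> * p)))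
       \<and> 0 \<le> \<Delta>"
proof -
  define s where "s = \<gamma> / p"
  define e where "e N = \<E>\<^sub>0 N \<Theta>" for N
  define a where "a N k = \<alpha> k N \<Theta>" for N k
  define A where "A N = (\<Sum>k=1..N. a N k powr (s / (1 + s)))" for N
  define S where "S N = (\<Sum>k=1..N. a N k)" for N
  have s: "0 < s" using p_pos \<gamma>_pos by (simp add: s_def)
  have exponent: "\<gamma> / (p + \<gamma>) = s / (1 + s)"
    using p_pos \<gamma>_pos by (simp add: s_def field_simps)
  have a: "0 < a N k" if "k \<in> {1..N}" for N k
    using that \<alpha>_pos by (simp add: a_def)
  have e: "0 < e N" if "1 \<le> N" for N
    using that \<E>\<^sub>0_pos by (simp add: e_def)
  have S: "0 < S N" if "1 \<le> N" for N
    unfolding S_def using that a by (intro sum_pos) auto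
  have A: "0 < A N" if "1 \<le> N" for N
    unfolding A_def using that a by (intro sum_pos) force+
  have cost: "wall_clock (oracle_cost \<gamma>) N \<delta> = (\<Sum>k=1..N. (\<delta> k powr p) powr (- s))" for N \<delta>
    using p_pos by (simp add: wall_clock_def oracle_cost_def powr_powr s_def)
  have feasible_iff: "feasible \<E> \<Theta> \<epsilon> N \<delta> \<longleftrightarrow> 1 \<le> N \<and> (\<forall>k\<in>{1..N}. 0 < \<delta> k) \<and>
      (\<Sum>k=1..N. a N k * \<delta> k powr p) \<le> \<epsilon> - e N" for \<epsilon> N \<delta>
    using bound[of N \<delta>] by (auto simp: feasible_def e_def a_def)
  have budget_pos: "0 < \<epsilon> - e N" if "feasible \<E> \<Theta> \<epsilon> N \<delta>" for \<epsilon> N \<delta>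
  proof -
    have "0 < (\<Sum>k=1..N. a N k * \<delta> k powr p)"
      using that a by (intro sum_pos) (force simp: feasible_iff)+
    then show ?thesis using that by (simp add: feasible_iff)
  qed

  let ?V = "reduced_costs (\<lambda>N. A N powr (1 + s)) e s"
  let ?V' = "reduced_costs (\<lambda>N. real N * S N powr s) e s"

  have free_sub: "?V \<epsilon> \<subseteq> attainable_times \<E> \<Theta> \<epsilon> \<gamma>" for \<epsilon>
  proof
    fix v assume "v \<in> ?V \<epsilon>"
    then obtain N where N: "1 \<le> N" "e N < \<epsilon>" "v = A N powr (1 + s) * (\<epsilon> - e N) powr (- s)"
      unfolding reduced_costs_def by blast
    obtain x where x: "\<And>k. k \<in> {1..N} \<Longrightarrow> 0 < x k" "(\<Sum>k=1..N. a N k * x k) = \<epsilon> - e N"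
      "(\<Sum>k=1..N. x k powr (- s)) = v"
      using allocation_cost_attained[of "{1..N}" "a N" s "\<epsilon> - e N"] N a s
      unfolding A_def by auto
    define \<delta> where "\<delta> k = x k powr (1 / p)" for k
    have \<delta>: "\<delta> k powr p = x k" "0 < \<delta> k" if "k \<in> {1..N}" for k
      using x(1)[OF that] p_pos by (simp_all add: \<delta>_def powr_powr)
    have "feasible \<E> \<Theta> \<epsilon> N \<delta>"
      unfolding feasible_iff using N x(2) by (simp add: \<delta>)
    moreover have "wall_clock (oracle_cost \<gamma>) N \<delta> = v"
      using x(3) by (simp add: cost \<delta>)
    ultimately show "v \<in> attainable_times \<E> \<Theta> \<epsilon> \<gamma>"
      unfolding attainable_times_def by blast
  qed
  have free_cofinal: "\<exists>v\<in>?V \<epsilon>. v \<le> t" if t: "t \<in> attainable_times \<E> \<Theta> \<epsilon> \<gamma>" for \<epsilon> t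
  proof -
    obtain N \<delta> where N: "feasible \<E> \<Theta> \<epsilon> N \<delta>" "t = wall_clock (oracle_cost \<gamma>) N \<delta>"
      using t unfolding attainable_times_def by blast
    have "A N powr (1 + s) * (\<epsilon> - e N) powr (- s) \<le> t"
      unfolding N(2) cost A_def using N(1) budget_pos[OF N(1)] a s
      by (intro allocation_cost_ge) (force simp: feasible_iff)+
    moreover have "A N powr (1 + s) * (\<epsilon> - e N) powr (- s) \<in> ?V \<epsilon>"
      using N(1) budget_pos[OF N(1)] unfolding reduced_costs_def feasible_iff by force
    ultimately show ?thesis by blast
  qed

  have unif_sub: "?V' \<epsilon> \<subseteq> attainable_times_unif \<E> \<Theta> \<epsilon> \<gamma>" for \<epsilon>
  proof
    fix v assume "v \<in> ?V' \<epsilon>"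
    then obtain N where N: "1 \<le> N" "e N < \<epsilon>" "v = real N * S N powr s * (\<epsilon> - e N) powr (- s)"
      unfolding reduced_costs_def by blast
    \<comment> \<open>the common fidelity that uses up the whole budget\<close>
    define \<delta> :: "nat \<Rightarrow> real" where "\<delta> = (\<lambda>k. ((\<epsilon> - e N) / S N) powr (1 / p))"
    have \<delta>: "\<delta> k powr p = (\<epsilon> - e N) / S N" "0 < \<delta> k" for k
      using N S[of N] p_pos by (simp_all add: \<delta>_def powr_powr)
    have "(\<Sum>k=1..N. a N k * \<delta> k powr p) = S N * ((\<epsilon> - e N) / S N)"
      unfolding \<delta> S_def by (simp only: sum_distrib_right)
    also have "\<dots> = \<epsilon> - e N" using S[OF N(1)] by simp
    finally have "feasible \<E> \<Theta> \<epsilon> N \<delta>"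
      unfolding feasible_iff using N \<delta>(2) by simp
    moreover have "wall_clock (oracle_cost \<gamma>) N \<delta> = v"
      unfolding cost \<delta> N(3) by (simp add: powr_divide powr_minus field_simps)
    moreover have "\<forall>j\<in>{1..N}. \<forall>k\<in>{1..N}. \<delta> j = \<delta> k" by (simp add: \<delta>_def)
    ultimately show "v \<in> attainable_times_unif \<E> \<Theta> \<epsilon> \<gamma>"
      unfolding attainable_times_unif_def by blast
  qed
  have unif_cofinal: "\<exists>v\<in>?V' \<epsilon>. v \<le> t" if t: "t \<in> attainable_times_unif \<E> \<Theta> \<epsilon> \<gamma>" for \<epsilon> t
  proof -
    obtain N \<delta> where N: "feasible \<E> \<Theta> \<epsilon> N \<delta>" "t = wall_clock (oracle_cost \<gamma>) N \<delta>"
      and const: "\<forall>j\<in>{1..N}. \<forall>k\<in>{1..N}. \<delta> j = \<delta> k"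
      using t unfolding attainable_times_unif_def by blast
    have N1: "1 \<le> N" using N(1) by (simp add: feasible_iff)
    define x where "x = \<delta> 1 powr p"
    have x: "\<delta> k powr p = x" if "k \<in> {1..N}" for k
      using const that N1 unfolding x_def by (metis atLeastAtMost_iff order_refl)
    have x_pos: "0 < x" using N(1) N1 by (force simp: x_def feasible_iff)
    have "S N * x \<le> \<epsilon> - e N"
      using N(1) by (simp add: feasible_iff x S_def sum_distrib_right)
    then have "x \<le> (\<epsilon> - e N) / S N"
      using S[OF N1] by (simp add: field_simps)
    then have "((\<epsilon> - e N) / S N) powr (- s) \<le> x powr (- s)"
      using x_pos s by (intro powr_mono2') auto
    then have "real N * ((\<epsilon> - e N) / S N) powr (- s) \<le> t"
      by (simp add: N(2) cost x mult_left_mono)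
    then have "real N * S N powr s * (\<epsilon> - e N) powr (- s) \<le> t"
      by (simp add: powr_divide powr_minus field_simps)
    moreover have "real N * S N powr s * (\<epsilon> - e N) powr (- s) \<in> ?V' \<epsilon>"
      using N1 budget_pos[OF N(1)] unfolding reduced_costs_def by force
    ultimately show ?thesis by blast
  qed

  have e_order: "same_order sequentially e (\<lambda>N. real N powr (- \<beta>))"
    using \<E>\<^sub>0_order by (simp add: e_def[abs_def])
  have A_order: "same_order sequentially (\<lambda>N. A N powr (1 + s)) (\<lambda>N. real N powr (\<rho> * (1 + s)))"
    using same_order_powr[OF \<alpha>_powr_order, of "1 + s"]
    unfolding exponent A_def a_def by (simp only: powr_powr)
  have "same_order sequentially real real"
    by (intro same_order_refl_pos eventually_sequentiallyI[of 1]) simp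
  then have "same_order sequentially (\<lambda>N. real N * S N powr s)
      (\<lambda>N. real N * (real N powr \<sigma>) powr s)"
    using \<alpha>_order unfolding S_def a_def by (intro same_order_mult same_order_powr)
  moreover have "real N * (real N powr \<sigma>) powr s = real N powr (1 + \<sigma> * s)" for N
    by (simp add: powr_powr powr_add)
  ultimately have S_order:
    "same_order sequentially (\<lambda>N. real N * S N powr s) (\<lambda>N. real N powr (1 + \<sigma> * s))"
    by simp
  have W_pos: "0 < A N powr (1 + s)" "0 < real N * S N powr s" if "1 \<le> N" for N
    using A[OF that] S[OF that] that by simp_all
  have \<tau>: "0 < \<rho> * (1 + s)" "0 < 1 + \<sigma> * s"
  proof -
    show "0 < \<rho> * (1 + s)" using s \<rho>_pos by simp
    have "1 + \<sigma> * s = (p + \<sigma> * \<gamma>) / p" using p_pos by (simp add: s_def field_simps)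
    then show "0 < 1 + \<sigma> * s" using p_pos \<sigma>_cond by simp
  qed

  let ?T = "\<lambda>\<epsilon>. T_total \<E> \<Theta> \<epsilon> \<gamma>" and ?U = "\<lambda>\<epsilon>. T_total_unif \<E> \<Theta> \<epsilon> \<gamma>"
  have T: "is_minimum (?V \<epsilon>) (?T \<epsilon>)" "is_minimum (attainable_times \<E> \<Theta> \<epsilon> \<gamma>) (?T \<epsilon>)"
    if \<epsilon>: "0 < \<epsilon>" for \<epsilon>
  proof -
    obtain t where t: "is_minimum (?V \<epsilon>) t"
      using reduced_costs_minimum[OF e_order A_order e W_pos(1) \<beta>_pos \<tau>(1) s \<epsilon>] by blast
    note t' = is_minimum_cofinal[OF free_sub free_cofinal t]
    have "?T \<epsilon> = t"
      unfolding T_total_def by (rule is_minimum_The[OF t'])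
    then show "is_minimum (?V \<epsilon>) (?T \<epsilon>)" "is_minimum (attainable_times \<E> \<Theta> \<epsilon> \<gamma>) (?T \<epsilon>)"
      using t t' by simp_all
  qed
  have U: "is_minimum (?V' \<epsilon>) (?U \<epsilon>)" "is_minimum (attainable_times_unif \<E> \<Theta> \<epsilon> \<gamma>) (?U \<epsilon>)"
    if \<epsilon>: "0 < \<epsilon>" for \<epsilon>
  proof -
    obtain t where t: "is_minimum (?V' \<epsilon>) t"
      using reduced_costs_minimum[OF e_order S_order e W_pos(2) \<beta>_pos \<tau>(2) s \<epsilon>] by blast
    note t' = is_minimum_cofinal[OF unif_sub unif_cofinal t]
    have "?U \<epsilon> = t"
      unfolding T_total_unif_def by (rule is_minimum_The[OF t'])
    then show "is_minimum (?V' \<epsilon>) (?U \<epsilon>)" "is_minimum (attainable_times_unif \<E> \<Theta> \<epsilon> \<gamma>) (?U \<epsilon>)"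
      using t t' by simp_all
  qed

  have T_order: "same_order (at_right 0) ?T (\<lambda>\<epsilon>. \<epsilon> powr (- (\<rho> * (1 + s) / \<beta> + s)))"
    by (rule reduced_costs_order[OF e_order A_order e W_pos(1) \<beta>_pos \<tau>(1) s T(1)])
  have U_order: "same_order (at_right 0) ?U (\<lambda>\<epsilon>. \<epsilon> powr (- ((1 + \<sigma> * s) / \<beta> + s)))"
    by (rule reduced_costs_order[OF e_order S_order e W_pos(2) \<beta>_pos \<tau>(2) s U(1)])
  have U_pos: "0 < ?U \<epsilon>" if \<epsilon>: "0 < \<epsilon>" for \<epsilon>
  proof -
    obtain N where "1 \<le> N" "e N < \<epsilon>" "?U \<epsilon> = real N * S N powr s * (\<epsilon> - e N) powr (- s)"
      using U(1)[OF \<epsilon>] by (auto simp: is_minimum_def reduced_costs_def)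
    then show ?thesis using S[of N] by simp
  qed
  have eps: "\<forall>\<^sub>F \<epsilon> in at_right 0. (0::real) < \<epsilon>"
    by (rule eventually_at_right_less)
  have "(- (\<rho> * (1 + s) / \<beta> + s)) - (- ((1 + \<sigma> * s) / \<beta> + s)) = \<Delta> / (\<beta> * p)"
    using p_pos \<beta>_pos by (simp add: \<Delta>_eq s_def field_simps)
  then have exps: "\<epsilon> powr (- (\<rho> * (1 + s) / \<beta> + s)) / \<epsilon> powr (- ((1 + \<sigma> * s) / \<beta> + s))
      = \<epsilon> powr (\<Delta> / (\<beta> * p))" for \<epsilon>
    by (simp only: flip: powr_diff)
  have R_order: "same_order (at_right 0) (\<lambda>\<epsilon>. R_opt \<E> \<Theta> \<epsilon> \<gamma>) (\<lambda>\<epsilon>. \<epsilon> powr (\<Delta> / (\<beta> * p)))"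
    using same_order_divide[OF T_order U_order] by (simp only: R_opt_def exps)

  have "0 \<le> \<Delta>"
  proof (rule ccontr)
    assume "\<not> 0 \<le> \<Delta>"
    then have neg: "0 < - \<Delta> / (\<beta> * p)" using \<beta>_pos p_pos by (simp add: divide_neg_pos)
    obtain c where c: "0 < c"
      "\<forall>\<^sub>F \<epsilon> in at_right 0. c \<le> R_opt \<E> \<Theta> \<epsilon> \<gamma> / \<epsilon> powr (\<Delta> / (\<beta> * p))"
      using R_order unfolding same_order_def eventually_conj_iff by blast
    have "((\<lambda>\<epsilon>::real. \<epsilon> powr (- \<Delta> / (\<beta> * p))) \<longlongrightarrow> 0 powr (- \<Delta> / (\<beta> * p))) (at_right 0)"
      using neg eps by (intro tendsto_powr' tendsto_const tendsto_ident_at)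
        (auto elim: eventually_mono)
    then have "\<forall>\<^sub>F \<epsilon> in at_right 0. \<epsilon> powr (- \<Delta> / (\<beta> * p)) < c"
      using c(1) by (auto dest: order_tendstoD(2))
    then have "\<forall>\<^sub>F \<epsilon>::real in at_right 0. False"
      using c(2) eps
    proof eventually_elim
      case (elim \<epsilon>)
      have "attainable_times_unif \<E> \<Theta> \<epsilon> \<gamma> \<subseteq> attainable_times \<E> \<Theta> \<epsilon> \<gamma>"
        unfolding attainable_times_def attainable_times_unif_def by blast
      then have "?T \<epsilon> \<le> ?U \<epsilon>"
        using T(2) U(2) elim(3) unfolding is_minimum_def by blast
      then have "R_opt \<E> \<Theta> \<epsilon> \<gamma> \<le> 1"
        using U_pos elim(3) by (simp add: R_opt_def)
      then have "R_opt \<E> \<Theta> \<epsilon> \<gamma> / \<epsilon> powr (\<Delta> / (\<beta> * p)) \<le> 1 / \<epsilon> powr (\<Delta> / (\<beta> * p))"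
        by (intro divide_right_mono) auto
      also have "\<dots> = \<epsilon> powr (- \<Delta> / (\<beta> * p))"
        by (simp add: powr_minus_divide)
      finally show False using elim by simp
    qed
    then show False by simp
  qed
  then show ?thesis using T(2) U(2) R_order by blast
qed

end
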